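(* Let $A$ be a real $N\times N$ matrix with $\rho(|A|)<1$, let $L\ge1$, and let $\mathcal{B}$ be a finite family of subsets of $\{1,\dots,N\}$ such that (1) every orbit $\ell$ of $A$ with $|\ell|<L$ is covered by some $B\in\mathcal{B}$, and (2) $B,B'\in\mathcal{B}$ implies $B\cap B'\in\mathcal{B}$. With block weights $w_B$ and $Z_{\mathcal{B}}=\prod_{B\in\mathcal{B}}\big(\det(I-A_B)^{-1}\big)^{w_B}$ as in the context, $$Z_{\mathcal{B}}=\prod_{\ell\in\mathcal{L}_{\mathcal{B}}}(1-A^\ell)^{-1},$$ where $\mathcal{L}_{\mathcal{B}}=\bigcup_{B\in\mathcal{B}}\mathcal{L}_B$ and $\mathcal{L}_B$ is the set of orbits of $A$ covered by $B$.
   Context: $|A|$ is the entrywise absolute value and $\rho$ the spectral radius. Walks of $A$: sequences $(w_0,\dots,w_m)$ of indices in $\{1,\dots,N\}$ with $A_{w_tw_{t+1}}\neq0$ for all $t$; closed if $m\ge1$ and $w_0=w_m$; a closed walk is primitive if it is not an $k$-fold concatenation ($k\ge2$) of a shorter closed walk. An orbit is an equivalence class of closed primitive walks under cyclic shifts; its length $|\ell|$ is the length of a representative; $A^\ell=\prod_{t}A_{w_tw_{t+1}}$ over the steps of a representative. An orbit is covered by $B$ if all of its vertices lie in $B$. $A_B$ is the principal $|B|\times|B|$ submatrix of $A$ on $B$ (with $\det(I-A_\emptyset)=1$). Block weights: $w_B=1$ if $B$ is maximal in $\mathcal{B}$ (not properly contained in another member), and otherwise $w_B=1-\sum_{B'\in\mathcal{B},\,B'\supsetneq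 B}w_{B'}$ (defined recursively downward by inclusion). *)

theory Defs
  imports "HOL-Analysis.Analysis" "Jordan_Normal_Form.Spectral_Radius" "Jordan_Normal_Form.DL_Submatrix"
begin

text \<open>Indices are 0-based: \<open>{0..<N}\<close> plays the role of \<open>{1,...,N}\<close>.
  A closed walk \<open>(w_0,...,w_m)\<close> with \<open>w_m = w_0\<close>, \<open>m \<ge> 1\<close>, is represented by the
  nonempty list \<open>[w_0,...,w_{m-1}]\<close>; its steps are \<open>xs!i \<rightarrow> xs!((i+1) mod m)\<close>.\<close>

definition closed_walk :: "real mat \<Rightarrow> nat list \<Rightarrow> bool" where
  "closed_walk A xs \<longleftrightarrow> xs \<noteq> [] \<and> set xs \<subseteq> {..<dim_row A} \<and>
     (\<forall>i<length xs. A $$ (xs ! i, xs ! ((i + 1) mod length xs)) \<noteq> 0)"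

definition primitive_walk :: "nat list \<Rightarrow> bool" where
  "primitive_walk xs \<longleftrightarrow> \<not> (\<exists>ys k. k \<ge> 2 \<and> xs = concat (replicate k ys))"

definition walk_weight :: "real mat \<Rightarrow> nat list \<Rightarrow> real" where
  "walk_weight A xs = (\<Prod>i<length xs. A $$ (xs ! i, xs ! ((i + 1) mod length xs)))"

definition orbits :: "real mat \<Rightarrow> nat list set set" where
  "orbits A = {{rotate i xs | i. True} | xs. closed_walk A xs \<and> primitive_walk xs}"

definition orbit_len :: "nat list set \<Rightarrow> nat" where
  "orbit_len l = length (SOME xs. xs \<in> l)"

definition orbit_weight :: "real mat \<Rightarrow> nat list set \<Rightarrow> real" where
  "orbit_weight A l = walk_weight A (SOME xs. xs \<in> l)"

definition covered_by :: "nat list set \<Rightarrow> nat set \<Rightarrow> bool" where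
  "covered_by l B \<longleftrightarrow> (\<forall>xs\<in>l. set xs \<subseteq> B)"

text \<open>Block weights, computed by recursion downward along inclusion. The recursion
  depth is bounded by \<open>card \<B>\<close> (length of a strict chain in \<open>\<B>\<close>), so fuel
  \<open>card \<B>\<close> suffices; at fuel 0 the value is 1 (maximal blocks have empty sum anyway).\<close>
fun block_weight_fuel :: "nat \<Rightarrow> nat set set \<Rightarrow> nat set \<Rightarrow> int" where
  "block_weight_fuel 0 \<B> B = 1"
| "block_weight_fuel (Suc n) \<B> B =
     1 - (\<Sum>B'\<in>{B' \<in> \<B>. B \<subset> B'}. block_weight_fuel n \<B> B')"

definition block_weight :: "nat set set \<Rightarrow> nat set \<Rightarrow> int" where
  "block_weight \<B> B = block_weight_fuel (card \<B>) \<B> B"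

definition principal_submatrix :: "real mat \<Rightarrow> nat set \<Rightarrow> real mat" where
  "principal_submatrix A B = submatrix A B B"

definition Z_blocks :: "real mat \<Rightarrow> nat set set \<Rightarrow> real" where
  "Z_blocks A \<B> = (\<Prod>B\<in>\<B>.
     (inverse (det (1\<^sub>m (dim_row (principal_submatrix A B)) - principal_submatrix A B)))
       powi (block_weight \<B> B))"

end

theory Submission
  imports Defs
begin

text \<open>Take logarithms. For a block \<open>B\<close>, triangularising \<open>A_B\<close> over the complex numbers gives
  \<open>- log det (I - A_B) = \<Sum>k\<ge>1. tr (A_B^k) / k\<close>, and \<open>tr (A_B^k)\<close> is the sum of the weights of
  the closed walks of length \<open>k\<close> inside \<open>B\<close>. The hypothesis on the spectral radius of \<open>|A|\<close> makes
  all sums over closed walks absolutely convergent. For a closed walk with vertex set \<open>V\<close> covered by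
  the family, the members containing \<open>V\<close> have a least element because the family is closed under
  intersection, so the block weights of these members add up to 1. Hence \<open>log Z\<close> is the sum of
  \<open>weight / length\<close> over all covered closed walks. Every closed walk is a unique power of a primitive
  one, and an orbit \<open>l\<close> consists of exactly \<open>|l|\<close> primitive walks, so that grouping the walks by orbit
  leaves \<open>\<Sum>l. \<Sum>k\<ge>1. (A^l)^k / k = \<Sum>l. - log (1 - A^l)\<close>.\<close>

subsection \<open>Primitive words\<close>

lemma length_concat_replicate: "length (concat (replicate k xs)) = k * length xs"
  by (induction k) auto

lemma set_concat_replicate: "k > 0 \<Longrightarrow> set (concat (replicate k xs)) = set xs"
  by (cases k) auto

lemma nth_concat_replicate:
  assumes "i < k * length xs"
  shows "concat (replicate k xs) ! i = xs ! (i mod length xs)"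
  using assms
proof (induction k arbitrary: i)
  case (Suc k)
  show ?case
  proof (cases "i < length xs")
    case False
    then show ?thesis
      using Suc.IH[of "i - length xs"] Suc.prems by (auto simp: nth_append le_mod_geq)
  qed (auto simp: nth_append)
qed simp

lemma concat_replicate_mult:
  "concat (replicate k (concat (replicate j xs))) = concat (replicate (k * j) xs)"
  by (induction k) (auto simp: replicate_add)

lemma concat_replicate_append_commute:
  "concat (replicate k xs) @ xs = xs @ concat (replicate k xs)"
  by (induction k) auto

lemma primitive_walk_power_one:
  assumes "primitive_walk p" "p = concat (replicate k z)" "p \<noteq> []"
  shows "p = z"
proof -
  have "k \<noteq> 0" using assms(2,3) by (intro notI) simp
  moreover have "\<not> k \<ge> 2" using assms(1,2) unfolding primitive_walk_def by blast
  ultimately have "k = 1" by linarith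
  then show ?thesis using assms(2) by simp
qed

text \<open>Descent on length: a non-primitive nonempty word is a proper power of a shorter nonempty
  word, and powers of powers are powers.\<close>

lemma primitive_root_exists:
  assumes "xs \<noteq> []"
  obtains p k where "primitive_walk p" "p \<noteq> []" "k > 0" "xs = concat (replicate k p)"
proof -
  have "\<exists>p k. primitive_walk p \<and> p \<noteq> [] \<and> k > 0 \<and> xs = concat (replicate k p)"
    using assms
  proof (induction "length xs" arbitrary: xs rule: less_induct)
    case less
    show ?case
    proof (cases "primitive_walk xs")
      case True
      then show ?thesis using less.prems
        by (intro exI[of _ xs] exI[of _ "1::nat"]) simp
    next
      case False
      then obtain ys k where ys: "k \<ge> 2" "xs = concat (replicate k ys)"
        unfolding primitive_walk_def by blast
      then have ne: "ys \<noteq> []" using less.prems by auto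
      then have "length ys < length xs"
        using ys by (simp add: length_concat_replicate)
      from less.hyps[OF this ne] obtain p j where
        p: "primitive_walk p" "p \<noteq> []" "j > 0" "ys = concat (replicate j p)" by blast
      have "xs = concat (replicate (k * j) p)"
        unfolding ys(2) p(4) by (rule concat_replicate_mult)
      then show ?thesis using p ys(1) by (intro exI[of _ p] exI[of _ "k * j"]) simp
    qed
  qed
  then show ?thesis using that by blast
qed

text \<open>Both \<open>p @ q\<close> and \<open>q @ p\<close> are prefixes of \<open>w @ w\<close>, where \<open>w\<close> is the common power.\<close>

lemma common_power_append:
  assumes "concat (replicate k p) = w" "concat (replicate j q) = w" "k > 0" "j > 0"
  shows "take (length p + length q) (w @ w) = p @ q"
proof -
  obtain k' where k: "k = Suc k'" using assms(3) by (cases k) auto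
  obtain j' where j: "j = Suc j'" using assms(4) by (cases j) auto
  define u where "u = concat (replicate k' p)"
  define v where "v = concat (replicate j' q)"
  have w1: "w = p @ u" and w2: "w = u @ p" and w3: "w = q @ v"
    using assms(1,2) unfolding u_def v_def k j
    by (auto simp: concat_replicate_append_commute)
  \<comment> \<open>Appending \<open>p\<close> turns \<open>u @ w\<close> into \<open>w @ w\<close>,
    so \<open>u @ w\<close> itself starts with \<open>w\<close> and therefore with the prefix
    \<open>q\<close> of \<open>w\<close>.\<close>
  have "(u @ w) @ p = u @ (p @ u) @ p" using w1 by simp
  also have "\<dots> = w @ w" by (simp add: w2)
  finally have "(u @ w) @ p = w @ w" .
  then have "take (length w) ((u @ w) @ p) = w" by simp
  then have uw: "take (length w) (u @ w) = w" by simp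
  have len: "length q \<le> length w" using w3 by simp
  have "take (length q) (take (length w) (u @ w)) = take (length q) (u @ w)"
    unfolding take_take min_absorb1[OF len] ..
  moreover have "take (length q) w = q" using arg_cong[OF w3, of "take (length q)"] by simp
  ultimately have q: "take (length q) (u @ w) = q" unfolding uw by simp
  have "w @ w = p @ (u @ w)" by (subst (1) w1) simp
  then have "take (length p + length q) (w @ w) = take (length p + length q) (p @ (u @ w))"
    by (rule arg_cong)
  also have "\<dots> = p @ q" using q by (simp del: take_append add: take_append[of _ p])
  finally show ?thesis .
qed

text \<open>Two roots of the same word commute, since \<open>p @ q\<close> and \<open>q @ p\<close>
  are prefixes of equal length of its square. Commuting words are powers of one common word, and
  primitivity makes both equal to it. Comparing lengths then fixes the exponent.\<close>

lemma primitive_root_unique: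
  assumes "primitive_walk p" "primitive_walk q" "p \<noteq> []" "q \<noteq> []" "k > 0" "j > 0"
    and eq: "concat (replicate k p) = concat (replicate j q)"
  shows "p = q \<and> k = j"
proof -
  have "p @ q = q @ p"
    using common_power_append[OF refl eq[symmetric] assms(5,6)]
      common_power_append[OF refl eq assms(6,5)] eq
    by (simp add: add.commute)
  from comm_append_are_replicate[OF this] obtain m n zs where
    "p = concat (replicate m zs)" "q = concat (replicate n zs)" by metis
  then have pq: "p = q"
    using primitive_walk_power_one assms by metis
  moreover have "k * length p = j * length q"
    using arg_cong[OF eq, of length] by (simp add: length_concat_replicate)
  ultimately show ?thesis using assms(3) by simp
qed

section \<open>Cyclic shifts of words\<close>

lemma rotate_concat_replicate:
  "rotate i (concat (replicate k xs)) = concat (replicate k (rotate i xs))"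
proof (induction i)
  case (Suc i)
  have "rotate1 (concat (replicate k ys)) = concat (replicate k (rotate1 ys))" for ys :: "'a list"
  proof (cases ys)
    case (Cons a t)
    have "concat (replicate j (a # t)) @ [a] = a # concat (replicate j (t @ [a]))" for j
      by (induction j) auto
    then show ?thesis using Cons by (cases k) auto
  qed simp
  then show ?case using Suc by simp
qed simp

lemma rotate_inverse: "i \<le> length xs \<Longrightarrow> rotate (length xs - i) (rotate i xs) = xs"
  by (simp add: rotate_rotate)

lemma rotate_less_length:
  assumes "xs \<noteq> []"
  obtains j where "j < length xs" "rotate i xs = rotate j xs"
  using assms that[of "i mod length xs"] rotate_conv_mod[of i xs] by simp

text \<open>Shifting commutes with taking powers, so a power decomposition of a shifted word can be
  shifted back to one of the word itself.\<close>

lemma primitive_walk_rotate: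
  assumes "primitive_walk xs"
  shows "primitive_walk (rotate i xs)"
proof (cases "xs = []")
  case False
  show ?thesis unfolding primitive_walk_def
  proof safe
    fix ys :: "nat list" and k :: nat assume k: "2 \<le> k" and eq: "rotate i xs = concat (replicate k ys)"
    obtain j where j: "j < length xs" "rotate i xs = rotate j xs"
      using rotate_less_length[OF False] by blast
    have "xs = rotate (length xs - j) (concat (replicate k ys))"
      using rotate_inverse[of j xs] j eq by simp
    also have "\<dots> = concat (replicate k (rotate (length xs - j) ys))"
      by (rule rotate_concat_replicate)
    finally show False using assms k unfolding primitive_walk_def by blast
  qed
qed (use assms in simp)

text \<open>If two shifts agree, the word is fixed by a shift through some
  \<open>0 < d < length xs\<close>. Its parts before and after position \<open>d\<close> then
  commute, hence are powers of one word, which contradicts primitivity. This is why an orbit has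
  exactly as many members as its length.\<close>

lemma primitive_walk_rotate_inj:
  assumes "primitive_walk xs"
  shows "inj_on (\<lambda>i. rotate i xs) {..<length xs}"
proof -
  have no: False if ij: "i < j" "j < length xs" and eq: "rotate i xs = rotate j xs" for i j
  proof -
    \<comment> \<open>A shift by \<open>j\<close> followed by one by \<open>length xs - j\<close> is
      a full turn. Replacing \<open>j\<close> by \<open>i\<close> in it gives a proper shift by
      \<open>d\<close> that still fixes \<open>xs\<close>.\<close>
    define d where "d = length xs - j + i"
    have d: "0 < d" "d < length xs" using ij unfolding d_def by auto
    have "rotate d xs = rotate (length xs - j) (rotate j xs)"
      unfolding d_def eq[symmetric] by (simp add: rotate_rotate)
    also have "\<dots> = xs" using ij by (intro rotate_inverse) simp
    finally have "drop d xs @ take d xs = take d xs @ drop d xs"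
      using d by (simp add: rotate_drop_take)
    from comm_append_are_replicate[OF this] obtain m n zs where
      z: "drop d xs = concat (replicate m zs)" "take d xs = concat (replicate n zs)" by metis
    have "m \<noteq> 0" using d z(1) by (intro notI) simp
    moreover have "n \<noteq> 0" using d z(2) by (intro notI) auto
    ultimately have "n + m \<ge> 2" by linarith
    moreover have "xs = concat (replicate (n + m) zs)"
      using append_take_drop_id[of d xs] unfolding z by (simp add: replicate_add)
    ultimately show False
      using assms unfolding primitive_walk_def by blast
  qed
  show ?thesis
    by (rule inj_onI) (metis no lessThan_iff nat_neq_iff)
qed

lemma rotation_class_eq_image:
  assumes "xs \<noteq> []"
  shows "{rotate i xs | i. True} = (\<lambda>i. rotate i xs) ` {..<length xs}"
  using rotate_less_length[OF assms] by blast

lemma card_rotation_class: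
  assumes "primitive_walk xs" "xs \<noteq> []"
  shows "card {rotate i xs | i. True} = length xs"
  unfolding rotation_class_eq_image[OF assms(2)]
  by (simp add: card_image primitive_walk_rotate_inj[OF assms(1)])

lemma rotation_class_eqI:
  assumes "ys \<in> {rotate i xs | i. True}"
  shows "{rotate i ys | i. True} = {rotate i xs | i. True}"
proof (cases "xs = []")
  case False
  obtain j where j: "j < length xs" "ys = rotate j xs"
    using assms rotate_less_length[OF False] by blast
  have "xs = rotate (length xs - j) ys" using j rotate_inverse[of j xs] by simp
  then have "rotate i xs = rotate (i + (length xs - j)) ys" for i
    by (metis rotate_rotate)
  moreover have "rotate i ys = rotate (i + j) xs" for i using j by (simp add: rotate_rotate)
  ultimately show ?thesis by fast
qed (use assms in auto)

subsection \<open>Weights of closed walks\<close>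

lemma prod_mod_power:
  fixes h :: "nat \<Rightarrow> 'a :: comm_monoid_mult"
  shows "(\<Prod>i<k * n. h (i mod n)) = (\<Prod>i<n. h i) ^ k"
proof (induction k)
  case (Suc k)
  have "(\<Prod>i<Suc k * n. h (i mod n)) = (\<Prod>i<k * n. h (i mod n)) * (\<Prod>i = k * n..<k * n + n. h (i mod n))"
    using prod.atLeastLessThan_concat[of 0 "k * n" "k * n + n" "\<lambda>i. h (i mod n)"]
    by (simp add: lessThan_atLeast0 add.commute)
  also have "(\<Prod>i = k * n..<k * n + n. h (i mod n)) = (\<Prod>i<n. h i)"
    using prod.shift_bounds_nat_ivl[of "\<lambda>i. h (i mod n)" 0 "k * n" n]
    by (simp add: lessThan_atLeast0 add.commute)
  finally show ?case using Suc by (simp add: mult.commute)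
qed simp

text \<open>The step across the junction of two copies is the closing step of \<open>xs\<close>, so
  each copy contributes the full weight of \<open>xs\<close>.\<close>

lemma walk_weight_power: "walk_weight A (concat (replicate k xs)) = walk_weight A xs ^ k"
proof (cases "k = 0 \<or> xs = []")
  case True
  then show ?thesis by (auto simp: walk_weight_def)
next
  case False
  let ?n = "length xs" and ?ys = "concat (replicate k xs)"
  have *: "A $$ (?ys ! i, ?ys ! ((i + 1) mod length ?ys)) =
      A $$ (xs ! (i mod ?n), xs ! ((i mod ?n + 1) mod ?n))" if i: "i < k * ?n" for i
  proof -
    have "k * ?n > 0" using False by simp
    then have "(i + 1) mod (k * ?n) < k * ?n" by (rule mod_less_divisor)
    moreover have "(i + 1) mod (k * ?n) mod ?n = (i mod ?n + 1) mod ?n"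
      by (metis dvd_triv_right mod_add_left_eq mod_mod_cancel)
    ultimately show ?thesis
      using i by (simp add: length_concat_replicate nth_concat_replicate)
  qed
  have "walk_weight A ?ys = (\<Prod>i<k * ?n. A $$ (xs ! (i mod ?n), xs ! ((i mod ?n + 1) mod ?n)))"
    unfolding walk_weight_def using * by (intro prod.cong) (auto simp: length_concat_replicate)
  also have "\<dots> = walk_weight A xs ^ k"
    unfolding walk_weight_def
    by (rule prod_mod_power[where h = "\<lambda>i. A $$ (xs ! i, xs ! ((i + 1) mod ?n))"])
  finally show ?thesis .
qed

text \<open>The zipped form serves two purposes: a shift merely permutes its factors, and it matches
  the recursion for entries of matrix powers.\<close>

lemma walk_weight_conv_prod_list:
  "walk_weight A xs = prod_list (map (($$) A) (zip xs (rotate1 xs)))"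
proof -
  have "prod_list (map (($$) A) (zip xs (rotate1 xs))) =
      (\<Prod>i = 0..<length xs. map (($$) A) (zip xs (rotate1 xs)) ! i)"
    using prod.list_conv_set_nth[of "map (($$) A) (zip xs (rotate1 xs))"] by simp
  also have "\<dots> = walk_weight A xs"
    unfolding walk_weight_def lessThan_atLeast0
    by (intro prod.cong) (auto simp: nth_rotate1)
  finally show ?thesis by simp
qed

lemma walk_weight_rotate: "walk_weight A (rotate i xs) = walk_weight A xs"
proof (induction i)
  case (Suc i)
  have "walk_weight A (rotate1 ys) = walk_weight A ys" for ys
  proof -
    have "length us = length vs \<Longrightarrow> zip (rotate1 us) (rotate1 vs) = rotate1 (zip us vs)"
      for us vs :: "nat list"
      by (cases us; cases vs) auto
    then have "zip (rotate1 ys) (rotate1 (rotate1 ys)) = rotate1 (zip ys (rotate1 ys))"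
      by simp
    moreover have "prod_list (rotate1 zs) = prod_list zs" for zs :: "real list"
      by (cases zs) (auto simp: mult.commute)
    ultimately show ?thesis
      unfolding walk_weight_conv_prod_list by (simp flip: rotate1_map)
  qed
  then show ?case using Suc by simp
qed simp

text \<open>A finite product of reals vanishes only if a factor does. Invariance of closed walks
  under powers and shifts thus reduces to that of the weight, and words that are not walks
  contribute zero to the sums below.\<close>

lemma closed_walk_iff_weight:
  "closed_walk A xs \<longleftrightarrow> xs \<noteq> [] \<and> set xs \<subseteq> {..<dim_row A} \<and> walk_weight A xs \<noteq> 0"
  unfolding closed_walk_def walk_weight_def by auto

lemma closed_walk_power:
  assumes "k > 0"
  shows "closed_walk A (concat (replicate k xs)) \<longleftrightarrow> closed_walk A xs"
proof -
  have "concat (replicate k xs) = [] \<longleftrightarrow> xs = []" using assms by (cases k) auto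
  then show ?thesis
    unfolding closed_walk_iff_weight walk_weight_power set_concat_replicate[OF assms]
    using assms by simp
qed

lemma closed_walk_rotate: "closed_walk A (rotate i xs) \<longleftrightarrow> closed_walk A xs"
  by (simp add: closed_walk_iff_weight walk_weight_rotate)

subsection \<open>Traces of powers\<close>

lemma pow_mat_Suc_left:
  assumes "A \<in> carrier_mat n n"
  shows "A ^\<^sub>m Suc k = A * A ^\<^sub>m k"
proof (induction k)
  case (Suc k)
  have "A ^\<^sub>m Suc (Suc k) = (A * A ^\<^sub>m k) * A" using Suc by simp
  also have "\<dots> = A * (A ^\<^sub>m k * A)"
    by (rule assoc_mult_mat[of _ n n _ n _ n]) (use assms in auto)
  finally show ?case by simp
qed (use assms in auto)

lemma index_mult_mat_sum:
  assumes "A \<in> carrier_mat n m" "B \<in> carrier_mat m l" "i < n" "j < l"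
  shows "(A * B) $$ (i, j) = (\<Sum>k<m. A $$ (i, k) * B $$ (k, j))"
  using assms by (auto simp: scalar_prod_def lessThan_atLeast0 intro!: sum.cong)

lemma sum_lists_Suc:
  fixes f :: "'a list \<Rightarrow> 'b :: comm_monoid_add"
  assumes "finite S"
  shows "(\<Sum>xs | set xs \<subseteq> S \<and> length xs = Suc k. f xs) =
    (\<Sum>x\<in>S. \<Sum>xs | set xs \<subseteq> S \<and> length xs = k. f (x # xs))"
proof -
  have "(\<Sum>xs | set xs \<subseteq> S \<and> length xs = Suc k. f xs) =
      (\<Sum>(xs, x)\<in>{xs. set xs \<subseteq> S \<and> length xs = k} \<times> S. f (x # xs))"
    unfolding lists_length_Suc_eq
    by (subst sum.reindex) (auto simp: inj_on_def case_prod_unfold)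
  also have "\<dots> = (\<Sum>xs | set xs \<subseteq> S \<and> length xs = k. \<Sum>x\<in>S. f (x # xs))"
    by (rule sum.cartesian_product[symmetric])
  also have "\<dots> = (\<Sum>x\<in>S. \<Sum>xs | set xs \<subseteq> S \<and> length xs = k. f (x # xs))"
    by (rule sum.swap)
  finally show ?thesis .
qed

text \<open>Here \<open>xs\<close> lists the \<open>k\<close> interior vertices of a path of
  \<open>Suc k\<close> steps from \<open>i\<close> to \<open>j\<close>. The induction peels off the
  first step.\<close>

lemma index_pow_mat_sum_paths:
  fixes A :: "real mat"
  assumes A: "A \<in> carrier_mat n n" and "i < n" "j < n"
  shows "(A ^\<^sub>m Suc k) $$ (i, j) =
    (\<Sum>xs | set xs \<subseteq> {..<n} \<and> length xs = k. prod_list (map (($$) A) (zip (i # xs) (xs @ [j]))))"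
  using assms(2)
proof (induction k arbitrary: i)
  case 0
  have "{xs. set xs \<subseteq> {..<n} \<and> length xs = 0} = {[]}" by auto
  then show ?case using A by simp
next
  case (Suc k)
  have "(A ^\<^sub>m Suc (Suc k)) $$ (i, j) = (\<Sum>x<n. A $$ (i, x) * (A ^\<^sub>m Suc k) $$ (x, j))"
    unfolding pow_mat_Suc_left[OF A, of "Suc k"]
    by (rule index_mult_mat_sum[OF A pow_carrier_mat[OF A] Suc.prems assms(3)])
  also have "\<dots> = (\<Sum>x<n. \<Sum>xs | set xs \<subseteq> {..<n} \<and> length xs = k.
      prod_list (map (($$) A) (zip (i # x # xs) ((x # xs) @ [j]))))"
    by (intro sum.cong refl) (simp add: Suc.IH sum_distrib_left del: pow_mat.simps)
  also have "\<dots> = (\<Sum>xs | set xs \<subseteq> {..<n} \<and> length xs = Suc k.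
      prod_list (map (($$) A) (zip (i # xs) (xs @ [j]))))"
    by (rule sum_lists_Suc[symmetric]) simp
  finally show ?case .
qed

lemma trace_pow_mat_sum_walks:
  fixes A :: "real mat"
  assumes A: "A \<in> carrier_mat n n"
  shows "(\<Sum>i<n. (A ^\<^sub>m Suc k) $$ (i, i)) =
    (\<Sum>xs | set xs \<subseteq> {..<n} \<and> length xs = Suc k. walk_weight A xs)"
proof -
  have "(\<Sum>xs | set xs \<subseteq> {..<n} \<and> length xs = Suc k. walk_weight A xs) =
      (\<Sum>x<n. \<Sum>xs | set xs \<subseteq> {..<n} \<and> length xs = k. walk_weight A (x # xs))"
    by (rule sum_lists_Suc) simp
  also have "\<dots> = (\<Sum>i<n. (A ^\<^sub>m Suc k) $$ (i, i))"
    by (intro sum.cong refl)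
      (simp add: index_pow_mat_sum_paths[OF A] walk_weight_conv_prod_list del: pow_mat.simps)
  finally show ?thesis by simp
qed

section \<open>Traces and eigenvalues\<close>

lemma trace_mult_commute:
  fixes X Y :: "'a :: comm_semiring_1 mat"
  assumes "X \<in> carrier_mat n n" "Y \<in> carrier_mat n n"
  shows "(\<Sum>i<n. (X * Y) $$ (i, i)) = (\<Sum>i<n. (Y * X) $$ (i, i))"
proof -
  have "(\<Sum>i<n. (X * Y) $$ (i, i)) = (\<Sum>i<n. \<Sum>k<n. X $$ (i, k) * Y $$ (k, i))"
    using assms by (intro sum.cong refl) (simp add: index_mult_mat_sum[of _ n n _ n] del: index_mult_mat)
  also have "\<dots> = (\<Sum>k<n. \<Sum>i<n. Y $$ (k, i) * X $$ (i, k))"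
    by (subst sum.swap) (simp add: mult.commute)
  also have "\<dots> = (\<Sum>i<n. (Y * X) $$ (i, i))"
    using assms by (intro sum.cong refl) (simp add: index_mult_mat_sum[of _ n n _ n] del: index_mult_mat)
  finally show ?thesis .
qed

lemma trace_similar_mat:
  fixes A :: "'a :: comm_ring_1 mat"
  assumes "A \<in> carrier_mat n n" "similar_mat_wit A B P Q"
  shows "(\<Sum>i<n. A $$ (i, i)) = (\<Sum>i<n. B $$ (i, i))"
proof -
  note s = similar_mat_witD2[OF assms]
  have "(\<Sum>i<n. A $$ (i, i)) = (\<Sum>i<n. (P * (B * Q)) $$ (i, i))"
    using s by (simp add: assoc_mult_mat[of P n n B n Q n])
  also have "\<dots> = (\<Sum>i<n. ((B * Q) * P) $$ (i, i))"
    by (rule trace_mult_commute) (use s in auto)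
  also have "(B * Q) * P = B" using s by (simp add: assoc_mult_mat[of B n n Q n P n])
  finally show ?thesis .
qed

lemma upper_triangular_pow_mat:
  fixes B :: "'a :: comm_ring_1 mat"
  assumes B: "B \<in> carrier_mat n n" and ut: "upper_triangular B"
  shows "upper_triangular (B ^\<^sub>m k) \<and> (\<forall>i<n. (B ^\<^sub>m k) $$ (i, i) = (B $$ (i, i)) ^ k)"
proof (induction k)
  case 0
  then show ?case using B by simp
next
  case (Suc k)
  have ut0: "B $$ (i, j) = 0" "(B ^\<^sub>m k) $$ (i, j) = 0" if "j < i" "i < n" for i j
    using upper_triangularD[OF ut, of j i] upper_triangularD[OF conjunct1[OF Suc], of j i] that B by auto
  have idx: "(B ^\<^sub>m Suc k) $$ (i, j) = (\<Sum>l<n. (B ^\<^sub>m k) $$ (i, l) * B $$ (l, j))"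
    if "i < n" "j < n" for i j
    unfolding pow_mat.simps by (rule index_mult_mat_sum) (use B that in auto)
  have "(B ^\<^sub>m Suc k) $$ (i, j) = 0" if ij: "j < i" "i < n" for i j
    unfolding idx[OF ij(2) less_trans[OF ij]]
  proof (rule sum.neutral, rule ballI)
    fix l assume "l \<in> {..<n}"
    then show "(B ^\<^sub>m k) $$ (i, l) * B $$ (l, j) = 0"
      using ij ut0(1)[of j l] ut0(2)[of l i] by (cases "l < i") auto
  qed
  moreover have "(B ^\<^sub>m Suc k) $$ (i, i) = (B $$ (i, i)) ^ Suc k" if i: "i < n" for i
  proof -
    have "(B ^\<^sub>m Suc k) $$ (i, i) = (\<Sum>l\<in>{i}. (B ^\<^sub>m k) $$ (i, l) * B $$ (l, i))"
      unfolding idx[OF i i]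
    proof (rule sum.mono_neutral_right)
      show "\<forall>l\<in>{..<n} - {i}. (B ^\<^sub>m k) $$ (i, l) * B $$ (l, i) = 0"
        using i ut0 by (metis DiffE insertI1 lessThan_iff linorder_neqE_nat mult_zero_left mult_zero_right)
    qed (use i in auto)
    then show ?thesis using Suc i by (simp add: mult.commute del: pow_mat.simps)
  qed
  ultimately show ?case using B by (auto simp del: pow_mat.simps)
qed

text \<open>The numbers \<open>d i\<close> are the diagonal of a Schur form, that is, the
  eigenvalues with multiplicity. Traces of powers are similarity invariant and can be read off that
  diagonal.\<close>

lemma complex_mat_eigenvalue_traces:
  fixes M :: "complex mat"
  assumes M: "M \<in> carrier_mat n n"
  shows "\<exists>d. (\<forall>k. (\<Sum>i<n. (M ^\<^sub>m k) $$ (i, i)) = (\<Sum>i<n. d i ^ k)) \<and>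
    det (1\<^sub>m n - M) = (\<Prod>i<n. 1 - d i) \<and> (\<forall>i<n. eigenvalue M (d i))"
proof -
  obtain es where es: "char_poly M = (\<Prod>a\<leftarrow>es. [:- a, 1:])"
    using char_poly_factorized[OF M] by blast
  obtain B P Q where "schur_decomposition M es = (B, P, Q)" by (metis prod_cases3)
  from schur_decomposition[OF M es this] have
    sim: "similar_mat_wit M B P Q" and ut: "upper_triangular B" and "diag_mat B = es" by auto
  note B = similar_mat_witD2(5)[OF M sim]
  let ?d = "\<lambda>i. B $$ (i, i)"
  have cp: "char_poly M = (\<Prod>a\<leftarrow>diag_mat B. [:- a, 1:])" using es \<open>diag_mat B = es\<close> by simp
  have cp': "poly (char_poly M) x = (\<Prod>i<n. x - ?d i)" for x
  proof -
    have "poly (char_poly M) x = (\<Prod>a\<leftarrow>diag_mat B. x - a)"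
      unfolding cp poly_prod_list by (simp add: o_def)
    also have "\<dots> = (\<Prod>i<n. x - ?d i)"
      using B prod.distinct_set_conv_list[of "[0..<n]" "\<lambda>i. x - ?d i"]
      by (simp add: diag_mat_def o_def lessThan_atLeast0)
    finally show ?thesis .
  qed
  show ?thesis
  proof (intro exI[of _ ?d] conjI allI impI)
    fix k
    have "(\<Sum>i<n. (M ^\<^sub>m k) $$ (i, i)) = (\<Sum>i<n. (B ^\<^sub>m k) $$ (i, i))"
      by (rule trace_similar_mat[OF _ similar_mat_wit_pow[OF sim]]) (use M in simp)
    then show "(\<Sum>i<n. (M ^\<^sub>m k) $$ (i, i)) = (\<Sum>i<n. ?d i ^ k)"
      using upper_triangular_pow_mat[OF B ut] by simp
  next
    \<comment> \<open>The determinant is the characteristic polynomial evaluated at 1.\<close>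
    have "1\<^sub>m n - M = - char_matrix M 1"
      using M unfolding char_matrix_def by (intro eq_matI) auto
    then show "det (1\<^sub>m n - M) = (\<Prod>i<n. 1 - ?d i)"
      using cp'[of 1] char_poly_matrix[OF M, of 1] by simp
  next
    fix i assume "i < n"
    then have "poly (char_poly M) (?d i) = 0" unfolding cp' by auto
    then show "eigenvalue M (?d i)" using eigenvalue_root_char_poly[OF M] by simp
  qed
qed

section \<open>The logarithm of a determinant as a trace series\<close>

lemma sums_minus_Ln:
  fixes z :: complex
  assumes "norm z < 1"
  shows "(\<lambda>k. z ^ Suc k / of_nat (Suc k)) sums - Ln (1 - z)"
proof -
  have "(\<lambda>k. - (z ^ k / of_nat k)) sums Ln (1 - z)"
    using Ln_series'[of "- z"] assms by simp
  then have "(\<lambda>k. z ^ k / of_nat k) sums - Ln (1 - z)"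
    using sums_minus by fastforce
  \<comment> \<open>The term at index 0 is \<open>1 / 0 = 0\<close>, so the index shift leaves the
    sum unchanged.\<close>
  then show ?thesis by (subst sums_Suc_iff) simp
qed

lemma sums_minus_ln:
  fixes x :: real
  assumes "\<bar>x\<bar> < 1"
  shows "(\<lambda>k. x ^ Suc k / real (Suc k)) sums - ln (1 - x)"
proof -
  have "(\<lambda>k. - (x ^ k / real k)) sums ln (1 - x)"
    using ln_series'[of "- x"] assms by simp
  then have "(\<lambda>k. x ^ k / real k) sums - ln (1 - x)"
    using sums_minus by fastforce
  then show ?thesis by (subst sums_Suc_iff) simp
qed

text \<open>The logarithm series is summed over the eigenvalues. Stating the result through
  \<open>exp\<close> avoids the choice of branch: a sum of principal logarithms need not be the
  principal logarithm of the product.\<close>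

lemma det_eq_exp_trace_series:
  fixes A :: "real mat"
  assumes A: "A \<in> carrier_mat n n"
    and ev: "\<And>z. eigenvalue (map_mat complex_of_real A) z \<Longrightarrow> norm z < 1"
  obtains s where "(\<lambda>k. (\<Sum>i<n. (A ^\<^sub>m Suc k) $$ (i, i)) / real (Suc k)) sums s"
    and "det (1\<^sub>m n - A) = exp (- s)"
proof -
  let ?M = "map_mat complex_of_real A"
  have M: "?M \<in> carrier_mat n n" using A by simp
  obtain d where tr: "\<forall>k. (\<Sum>i<n. (?M ^\<^sub>m k) $$ (i, i)) = (\<Sum>i<n. d i ^ k)"
    and det: "det (1\<^sub>m n - ?M) = (\<Prod>i<n. 1 - d i)"
    and eig: "\<forall>i<n. eigenvalue ?M (d i)"
    using complex_mat_eigenvalue_traces[OF M] by blast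
  define S where "S = (\<Sum>i<n. - Ln (1 - d i))"
  have d1: "norm (d i) < 1" if "i < n" for i using ev eig that by blast
  have trr: "(\<Sum>i<n. d i ^ k) = of_real (\<Sum>i<n. (A ^\<^sub>m k) $$ (i, i))" for k
    unfolding tr[rule_format, symmetric] of_real_hom.mat_hom_pow[OF A, symmetric]
    using A by (simp del: pow_mat.simps)
  have "(\<lambda>k. \<Sum>i<n. d i ^ Suc k / of_nat (Suc k)) sums S"
    unfolding S_def by (intro sums_sum sums_minus_Ln d1) simp
  then have sums: "(\<lambda>k. of_real ((\<Sum>i<n. (A ^\<^sub>m Suc k) $$ (i, i)) / real (Suc k))) sums S"
    unfolding sum_divide_distrib[symmetric] trr by (simp del: pow_mat.simps)
  from sums_Re[OF this] have re: "(\<lambda>k. (\<Sum>i<n. (A ^\<^sub>m Suc k) $$ (i, i)) / real (Suc k)) sums Re S"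
    by (simp del: pow_mat.simps of_nat_Suc)
  \<comment> \<open>The series has real terms, so its complex sum coincides with the sum of its real
    parts.\<close>
  have S: "S = of_real (Re S)"
    by (rule sums_unique2[OF sums sums_of_real[OF re]])
  have "complex_of_real (det (1\<^sub>m n - A)) = det (1\<^sub>m n - ?M)"
  proof -
    have "map_mat complex_of_real (1\<^sub>m n - A) = 1\<^sub>m n - ?M"
      using A by (intro eq_matI) auto
    then show ?thesis using of_real_hom.hom_det[of "1\<^sub>m n - A", where 'a = complex] by simp
  qed
  also have "\<dots> = (\<Prod>i<n. exp (Ln (1 - d i)))"
    unfolding det
  proof (intro prod.cong refl)
    fix i assume "i \<in> {..<n}"
    then have "d i \<noteq> 1" using d1[of i] by auto
    then show "1 - d i = exp (Ln (1 - d i))" by simp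
  qed
  also have "\<dots> = exp (- S)" unfolding S_def by (simp add: exp_sum sum_negf)
  also have "\<dots> = of_real (exp (- Re S))" by (subst S) (simp flip: exp_of_real)
  finally have "det (1\<^sub>m n - A) = exp (- Re S)" unfolding of_real_eq_iff .
  with re show ?thesis by (rule that)
qed

text \<open>The trace is a finite sum of geometric sequences. Applied to the entrywise absolute
  value of \<open>A\<close>, this is the source of absolute convergence.\<close>

lemma summable_trace_pow_mat:
  fixes A :: "real mat"
  assumes A: "A \<in> carrier_mat n n"
    and ev: "\<And>z. eigenvalue (map_mat complex_of_real A) z \<Longrightarrow> norm z < 1"
  shows "summable (\<lambda>k. \<Sum>i<n. (A ^\<^sub>m k) $$ (i, i))"
proof -
  let ?M = "map_mat complex_of_real A"
  have M: "?M \<in> carrier_mat n n" using A by simp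
  obtain d where tr: "\<forall>k. (\<Sum>i<n. (?M ^\<^sub>m k) $$ (i, i)) = (\<Sum>i<n. d i ^ k)"
    and eig: "\<forall>i<n. eigenvalue ?M (d i)"
    using complex_mat_eigenvalue_traces[OF M] by blast
  have trr: "(\<Sum>i<n. d i ^ k) = of_real (\<Sum>i<n. (A ^\<^sub>m k) $$ (i, i))" for k
    unfolding tr[rule_format, symmetric] of_real_hom.mat_hom_pow[OF A, symmetric]
    using A by (simp del: pow_mat.simps)
  have "summable (\<lambda>k. \<Sum>i<n. d i ^ k)"
    using ev eig by (intro summable_sum summable_geometric) auto
  then show ?thesis unfolding trr by (simp only: summable_of_real_iff)
qed

lemma norm_eigenvalue_less_1:
  fixes M :: "complex mat"
  assumes "M \<in> carrier_mat n n" "spectral_radius M < 1" "eigenvalue M z"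
  shows "norm z < 1"
  using spectral_radius_mem_max(2)[OF assms(1) eigenvalue_imp_nonzero_dim[OF assms(1,3)], of "norm z"]
    assms by (force simp: spectrum_def)

subsection \<open>Block weights\<close>

text \<open>The number of strict supersets in the family drops at every recursive call, so that many
  units of fuel suffice and any surplus is harmless. With no strict superset the sum is empty and
  both clauses give 1.\<close>

lemma block_weight_fuel_stable:
  assumes "finite \<B>" "card {B' \<in> \<B>. B \<subset> B'} \<le> n" "card {B' \<in> \<B>. B \<subset> B'} \<le> m"
  shows "block_weight_fuel n \<B> B = block_weight_fuel m \<B> B"
  using assms(2,3)
proof (induction n arbitrary: m B)
  case 0
  then have "{B' \<in> \<B>. B \<subset> B'} = {}" using assms(1) by simp
  then show ?case by (cases m) (simp_all del: Collect_empty_eq)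
next
  case (Suc n)
  show ?case
  proof (cases m)
    case 0
    then have "{B' \<in> \<B>. B \<subset> B'} = {}" using assms(1) Suc.prems by simp
    then show ?thesis using 0 by (simp del: Collect_empty_eq)
  next
    case m: (Suc m')
    have "block_weight_fuel n \<B> B' = block_weight_fuel m' \<B> B'" if B': "B' \<in> \<B>" "B \<subset> B'" for B'
    proof (rule Suc.IH)
      have "card {C \<in> \<B>. B' \<subset> C} < card {C \<in> \<B>. B \<subset> C}"
        using assms(1) B' by (intro psubset_card_mono) auto
      then show "card {C \<in> \<B>. B' \<subset> C} \<le> n" "card {C \<in> \<B>. B' \<subset> C} \<le> m'"
        using Suc.prems m by auto
    qed
    then show ?thesis unfolding m by simp
  qed
qed

text \<open>Unfolding once spends one unit of fuel. The rest still suffices, since a member has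
  fewer than \<open>card \<B>\<close> strict supersets in the family.\<close>

lemma block_weight_rec:
  assumes "finite \<B>" "B \<in> \<B>"
  shows "block_weight \<B> B = 1 - (\<Sum>B' | B' \<in> \<B> \<and> B \<subset> B'. block_weight \<B> B')"
proof -
  obtain n where n: "card \<B> = Suc n" using assms by (cases "card \<B>") auto
  have "block_weight_fuel n \<B> B' = block_weight_fuel (card \<B>) \<B> B'" if "B' \<in> \<B>" for B'
  proof (rule block_weight_fuel_stable[OF assms(1)])
    have "card {C \<in> \<B>. B' \<subset> C} < card \<B>"
      using assms(1) that by (intro psubset_card_mono) auto
    then show "card {C \<in> \<B>. B' \<subset> C} \<le> n" "card {C \<in> \<B>. B' \<subset> C} \<le> card \<B>"
      using n by auto
  qed
  then show ?thesis unfolding block_weight_def by (subst n) simp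
qed

text \<open>The members containing \<open>V\<close> are those containing their intersection, the least of them.\<close>

lemma sum_block_weights_covering:
  assumes fin: "finite \<B>" and inter: "\<forall>B\<in>\<B>. \<forall>B'\<in>\<B>. B \<inter> B' \<in> \<B>"
    and ex: "\<exists>B\<in>\<B>. V \<subseteq> B"
  shows "(\<Sum>B | B \<in> \<B> \<and> V \<subseteq> B. block_weight \<B> B) = 1"
proof -
  let ?F = "{B \<in> \<B>. V \<subseteq> B}"
  have "finite ?F" "?F \<noteq> {}" using fin ex by auto
  from finite_has_minimal[OF this] obtain B0
    where B0F: "B0 \<in> ?F" and min: "\<forall>B\<in>?F. B \<subseteq> B0 \<longrightarrow> B0 = B"
    by (rule bexE)
  then have B0: "B0 \<in> \<B>" "V \<subseteq> B0" by auto
  have least: "B0 \<subseteq> B" if "B \<in> \<B>" "V \<subseteq> B" for B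
  proof -
    have "B0 \<inter> B \<in> ?F" using inter B0 that by simp
    with min show ?thesis by (metis Int_lower1 Int_lower2)
  qed
  \<comment> \<open>The weight of \<open>B0\<close> is 1 minus the sum over its strict supersets, so
    adding that sum back leaves 1.\<close>
  have F: "?F = insert B0 {B \<in> \<B>. B0 \<subset> B}" using B0 least by blast
  show ?thesis
    unfolding F using fin block_weight_rec[OF fin B0(1)] by (subst sum.insert) auto
qed

subsection \<open>Principal submatrices\<close>

text \<open>The matrix is rescaled by a factor \<open>t > 1\<close> that keeps the spectral radius below 1.\<close>

lemma pow_mat_geometric_bound:
  fixes M :: "complex mat"
  assumes M: "M \<in> carrier_mat n n" and sr: "spectral_radius M < 1"
  shows "\<exists>t c. t > 1 \<and> (\<forall>k i j. i < n \<longrightarrow> j < n \<longrightarrow> norm ((M ^\<^sub>m k) $$ (i, j)) * t ^ k \<le> c)"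
proof (cases "n = 0")
  case True
  then show ?thesis by (intro exI[of _ 2]) simp
next
  case False
  define r where "r = spectral_radius M"
  have r: "0 \<le> r" "r < 1"
    using spectral_radius_mem_max(1)[OF M] False sr unfolding r_def by auto
  \<comment> \<open>The reciprocal of the midpoint between \<open>r\<close> and 1, which is good
    also when \<open>r = 0\<close>.\<close>
  define t where "t = 2 / (1 + r)"
  have t: "t > 1" "t * r < 1" using r by (auto simp: t_def field_simps)
  define M' where "M' = complex_of_real t \<cdot>\<^sub>m M"
  have M': "M' \<in> carrier_mat n n" using M by (simp add: M'_def)
  have pow: "(M' ^\<^sub>m k) $$ (i, j) = of_real t ^ k * (M ^\<^sub>m k) $$ (i, j)" if "i < n" "j < n" for k i j
    using that
  proof (induction k arbitrary: j)
    case 0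
    then show ?case using M M' by simp
  next
    case (Suc k)
    have "(M' ^\<^sub>m Suc k) $$ (i, j) = (\<Sum>l<n. (M' ^\<^sub>m k) $$ (i, l) * M' $$ (l, j))"
      unfolding pow_mat.simps by (rule index_mult_mat_sum) (use M' Suc.prems in auto)
    also have "\<dots> = (\<Sum>l<n. of_real t ^ Suc k * ((M ^\<^sub>m k) $$ (i, l) * M $$ (l, j)))"
      using Suc.prems M by (intro sum.cong refl) (simp add: Suc.IH, simp add: M'_def)
    also have "\<dots> = of_real t ^ Suc k * (\<Sum>l<n. (M ^\<^sub>m k) $$ (i, l) * M $$ (l, j))"
      by (rule sum_distrib_left[symmetric])
    also have "(\<Sum>l<n. (M ^\<^sub>m k) $$ (i, l) * M $$ (l, j)) = (M ^\<^sub>m Suc k) $$ (i, j)"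
      unfolding pow_mat.simps by (rule index_mult_mat_sum[symmetric]) (use M Suc.prems in auto)
    finally show ?case .
  qed
  have "spectral_radius M' < 1"
  proof -
    obtain z where z: "eigenvalue M' z" and nz: "spectral_radius M' = norm z"
      using spectral_radius_mem_max(1)[OF M'] False by (auto simp: spectrum_def)
    obtain v where v: "v \<in> carrier_vec n" "v \<noteq> 0\<^sub>v n" "M' *\<^sub>v v = z \<cdot>\<^sub>v v"
      using z M' unfolding eigenvalue_def eigenvector_def by auto
    \<comment> \<open>Eigenvectors are unaffected by scaling: an eigenvalue \<open>z\<close> of
      \<open>M'\<close> yields \<open>z / t\<close> for \<open>M\<close>, whence
      \<open>norm z \<le> t * r\<close>.\<close>
    have "M *\<^sub>v v = (z / of_real t) \<cdot>\<^sub>v v"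
    proof (rule eq_vecI)
      fix i assume "i < dim_vec ((z / of_real t) \<cdot>\<^sub>v v)"
      then have i: "i < n" using v by simp
      have "of_real t * vec_index (M *\<^sub>v v) i = vec_index (M' *\<^sub>v v) i"
        using M v(1) i by (simp add: M'_def scalar_prod_def sum_distrib_left mult_ac)
      also have "\<dots> = z * vec_index v i" unfolding v(3) using v i by simp
      finally show "vec_index (M *\<^sub>v v) i = vec_index ((z / of_real t) \<cdot>\<^sub>v v) i"
        using t v i by (simp add: field_simps)
    qed (use M v in simp)
    then have "eigenvalue M (z / of_real t)"
      unfolding eigenvalue_def eigenvector_def using v M by auto
    then have "norm (z / of_real t) \<le> r"
      unfolding r_def using False
      by (intro spectral_radius_mem_max(2)[OF M]) (auto simp: spectrum_def)
    then show ?thesis using t nz by (simp add: norm_divide field_simps)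
  qed
  \<comment> \<open>A spectral radius below 1 keeps the entries of all powers of \<open>M'\<close>
    uniformly bounded; undoing the scaling gives decay of the powers of \<open>M\<close> at rate
    \<open>1 / t\<close>.\<close>
  from spectral_radius_jnf_norm_bound_less_1_upper_triangular[OF M' this]
  obtain c where c: "\<forall>k. norm_bound (M' ^\<^sub>m k) c" by blast
  have "norm ((M ^\<^sub>m k) $$ (i, j)) * t ^ k \<le> c" if "i < n" "j < n" for k i j
  proof -
    have "norm ((M' ^\<^sub>m k) $$ (i, j)) \<le> c"
      using c that M' unfolding norm_bound_def by simp
    then show ?thesis using t by (simp add: pow[OF that] norm_mult norm_power mult.commute)
  qed
  with t(1) show ?thesis by blast
qed

text \<open>Paths of \<open>M\<close> correspond to the paths of \<open>A\<close> inside the range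
  of \<open>\<sigma>\<close>. Taking absolute values and then admitting all paths of
  \<open>A\<close> only increases the sum.\<close>

lemma abs_pow_mat_reindex_le:
  fixes A M :: "real mat"
  assumes A: "A \<in> carrier_mat n n" and M: "M \<in> carrier_mat m m"
    and inj: "inj_on \<sigma> {..<m}" and ran: "\<sigma> ` {..<m} \<subseteq> {..<n}"
    and idx: "\<And>i j. i < m \<Longrightarrow> j < m \<Longrightarrow> M $$ (i, j) = A $$ (\<sigma> i, \<sigma> j)"
    and "i < m" "j < m"
  shows "\<bar>(M ^\<^sub>m k) $$ (i, j)\<bar> \<le> (map_mat abs A ^\<^sub>m k) $$ (\<sigma> i, \<sigma> j)"
  using assms(6,7)
proof (induction k arbitrary: j)
  case 0
  then have "\<sigma> i < n" "\<sigma> j < n" using ran by auto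
  then show ?case using A M 0 by auto
next
  case (Suc k)
  let ?C = "map_mat abs A"
  have C: "?C \<in> carrier_mat n n" using A by simp
  have \<sigma>: "\<sigma> i < n" "\<sigma> j < n" using ran Suc.prems by auto
  have nonneg: "0 \<le> (?C ^\<^sub>m k) $$ (a, b)" if "a < n" "b < n" for a b
    using that
  proof (induction k arbitrary: b)
    case 0
    then show ?case using A by simp
  next
    case (Suc k)
    have "(?C ^\<^sub>m Suc k) $$ (a, b) = (\<Sum>l<n. (?C ^\<^sub>m k) $$ (a, l) * ?C $$ (l, b))"
      unfolding pow_mat.simps by (rule index_mult_mat_sum) (use C Suc.prems in auto)
    also have "\<dots> \<ge> 0" using Suc A by (intro sum_nonneg mult_nonneg_nonneg) auto
    finally show ?case .
  qed
  have "\<bar>(M ^\<^sub>m Suc k) $$ (i, j)\<bar> = \<bar>\<Sum>l<m. (M ^\<^sub>m k) $$ (i, l) * M $$ (l, j)\<bar>"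
    unfolding pow_mat.simps
    by (subst index_mult_mat_sum[of _ m m _ m]) (use M Suc.prems in auto)
  also have "\<dots> \<le> (\<Sum>l<m. \<bar>(M ^\<^sub>m k) $$ (i, l)\<bar> * \<bar>M $$ (l, j)\<bar>)"
    by (rule order_trans[OF sum_abs]) (simp add: abs_mult)
  also have "\<dots> \<le> (\<Sum>l<m. (?C ^\<^sub>m k) $$ (\<sigma> i, \<sigma> l) * ?C $$ (\<sigma> l, \<sigma> j))"
  proof (rule sum_mono)
    fix l assume "l \<in> {..<m}"
    then have l: "l < m" "\<sigma> l < n" using ran by auto
    then show "\<bar>(M ^\<^sub>m k) $$ (i, l)\<bar> * \<bar>M $$ (l, j)\<bar> \<le> (?C ^\<^sub>m k) $$ (\<sigma> i, \<sigma> l) * ?C $$ (\<sigma> l, \<sigma> j)"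
      using Suc.IH[OF Suc.prems(1) l(1)] idx[OF l(1) Suc.prems(2)] \<sigma> A
      by (intro mult_mono order_trans[OF abs_ge_zero Suc.IH]) (auto simp: Suc.prems)
  qed
  also have "\<dots> = (\<Sum>l\<in>\<sigma> ` {..<m}. (?C ^\<^sub>m k) $$ (\<sigma> i, l) * ?C $$ (l, \<sigma> j))"
    by (simp add: sum.reindex[OF inj])
  also have "\<dots> \<le> (\<Sum>l<n. (?C ^\<^sub>m k) $$ (\<sigma> i, l) * ?C $$ (l, \<sigma> j))"
    using ran \<sigma> nonneg A by (intro sum_mono2 mult_nonneg_nonneg) auto
  also have "\<dots> = (?C ^\<^sub>m Suc k) $$ (\<sigma> i, \<sigma> j)"
    unfolding pow_mat.simps by (rule index_mult_mat_sum[symmetric]) (use C \<sigma> in auto)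
  finally show ?case .
qed

text \<open>Powers of a submatrix are dominated by powers of the absolute value of \<open>A\<close>,
  which decay like \<open>t ^ k\<close> inverted. An eigenvalue with \<open>norm z \<ge> 1\<close>
  prevents such decay: at a coordinate where its eigenvector is nonzero it would keep
  \<open>t ^ k\<close> bounded.\<close>

lemma norm_eigenvalue_reindex_less_1:
  fixes A M :: "real mat"
  assumes A: "A \<in> carrier_mat n n" and M: "M \<in> carrier_mat m m"
    and inj: "inj_on \<sigma> {..<m}" and ran: "\<sigma> ` {..<m} \<subseteq> {..<n}"
    and idx: "\<And>i j. i < m \<Longrightarrow> j < m \<Longrightarrow> M $$ (i, j) = A $$ (\<sigma> i, \<sigma> j)"
    and sr: "spectral_radius (map_mat complex_of_real (map_mat abs A)) < 1"
    and ev: "eigenvalue (map_mat complex_of_real M) z"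
  shows "norm z < 1"
proof (rule ccontr)
  assume z: "\<not> norm z < 1"
  let ?C = "map_mat abs A" and ?M = "map_mat complex_of_real M"
  have C: "?C \<in> carrier_mat n n" "map_mat complex_of_real ?C \<in> carrier_mat n n" using A by auto
  have Mc: "?M \<in> carrier_mat m m" using M by simp
  obtain t c where t: "t > 1" and
    "\<forall>k i j. i < n \<longrightarrow> j < n \<longrightarrow> norm ((map_mat complex_of_real ?C ^\<^sub>m k) $$ (i, j)) * t ^ k \<le> c"
    using pow_mat_geometric_bound[OF C(2) sr] by blast
  then have bound: "(?C ^\<^sub>m k) $$ (i, j) * t ^ k \<le> c" if "i < n" "j < n" for i j k
  proof -
    have "(map_mat complex_of_real ?C ^\<^sub>m k) $$ (i, j) = of_real ((?C ^\<^sub>m k) $$ (i, j))"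
      unfolding of_real_hom.mat_hom_pow[OF C(1), symmetric] using that C by simp
    then have "\<bar>(?C ^\<^sub>m k) $$ (i, j)\<bar> * t ^ k \<le> c"
      using \<open>\<forall>k i j. i < n \<longrightarrow> j < n \<longrightarrow> _\<close> that by (metis norm_of_real real_norm_def)
    moreover have "(?C ^\<^sub>m k) $$ (i, j) * t ^ k \<le> \<bar>(?C ^\<^sub>m k) $$ (i, j)\<bar> * t ^ k"
      using t by (intro mult_right_mono) auto
    ultimately show ?thesis by linarith
  qed
  obtain v where v: "eigenvector ?M v z" using ev unfolding eigenvalue_def by blast
  then have vc: "v \<in> carrier_vec m" "v \<noteq> 0\<^sub>v m" using M unfolding eigenvector_def by auto
  then obtain i where i: "i < m" "vec_index v i \<noteq> 0" by (metis carrier_vecD eq_vecI index_zero_vec)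
  define V where "V = (\<Sum>j<m. norm (vec_index v j))"
  have "norm (vec_index v i) * t ^ k \<le> c * V" for k
  proof -
    have "z ^ k * vec_index v i = vec_index (?M ^\<^sub>m k *\<^sub>v v) i"
      unfolding eigenvector_pow[OF Mc v] using vc i by simp
    also have "\<dots> = (\<Sum>j<m. (?M ^\<^sub>m k) $$ (i, j) * vec_index v j)"
      using Mc vc i by (simp add: scalar_prod_def lessThan_atLeast0)
    also have "\<dots> = (\<Sum>j<m. of_real ((M ^\<^sub>m k) $$ (i, j)) * vec_index v j)"
      unfolding of_real_hom.mat_hom_pow[OF M, symmetric] using M i by (intro sum.cong) auto
    finally have "norm z ^ k * norm (vec_index v i) = norm (\<Sum>j<m. of_real ((M ^\<^sub>m k) $$ (i, j)) * vec_index v j)"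
      by (simp flip: norm_mult norm_power)
    also have "\<dots> \<le> (\<Sum>j<m. \<bar>(M ^\<^sub>m k) $$ (i, j)\<bar> * norm (vec_index v j))"
      by (rule order_trans[OF norm_sum]) (simp add: norm_mult)
    finally have "norm z ^ k * norm (vec_index v i) * t ^ k \<le> (\<Sum>j<m. \<bar>(M ^\<^sub>m k) $$ (i, j)\<bar> * norm (vec_index v j)) * t ^ k"
      using t by (intro mult_right_mono) auto
    also have "\<dots> = (\<Sum>j<m. (\<bar>(M ^\<^sub>m k) $$ (i, j)\<bar> * t ^ k) * norm (vec_index v j))"
      by (simp add: sum_distrib_left mult_ac)
    also have "\<dots> \<le> (\<Sum>j<m. c * norm (vec_index v j))"
    proof (intro sum_mono mult_right_mono)
      fix j assume "j \<in> {..<m}"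
      then have j: "j < m" by simp
      have "\<bar>(M ^\<^sub>m k) $$ (i, j)\<bar> * t ^ k \<le> (?C ^\<^sub>m k) $$ (\<sigma> i, \<sigma> j) * t ^ k"
        using abs_pow_mat_reindex_le[OF A M inj ran idx i(1) j] t by (intro mult_right_mono) auto
      also have "\<dots> \<le> c" using ran i j by (intro bound) auto
      finally show "\<bar>(M ^\<^sub>m k) $$ (i, j)\<bar> * t ^ k \<le> c" .
    qed simp
    also have "\<dots> = c * V" by (simp add: V_def sum_distrib_left)
    finally have "norm z ^ k * (norm (vec_index v i) * t ^ k) \<le> c * V" by (simp add: mult_ac)
    moreover have "1 * (norm (vec_index v i) * t ^ k) \<le> norm z ^ k * (norm (vec_index v i) * t ^ k)"
      using z t by (intro mult_right_mono one_le_power) auto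
    ultimately show ?thesis by linarith
  qed
  then have "t ^ k \<le> c * V / norm (vec_index v i)" for k
    using i by (simp add: field_simps)
  moreover obtain k where "c * V / norm (vec_index v i) < t ^ k" using real_arch_pow[OF t] by blast
  ultimately show False by (meson not_less)
qed

section \<open>Closed walks inside a block\<close>

lemma bij_betw_pick:
  assumes "finite B"
  shows "bij_betw (pick B) {..<card B} B"
proof -
  have "inj_on (pick B) {..<card B}"
    by (rule inj_onI) (metis lessThan_iff less_irrefl linorder_neqE_nat pick_mono_le)
  moreover have "pick B ` {..<card B} \<subseteq> B" using pick_in_set_le by auto
  ultimately show ?thesis
    using assms unfolding bij_betw_def by (simp add: card_image card_subset_eq)
qed

lemma principal_submatrix_index:
  assumes "A \<in> carrier_mat n n" "B \<subseteq> {..<n}"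
  shows "principal_submatrix A B \<in> carrier_mat (card B) (card B)"
    and "\<And>i j. i < card B \<Longrightarrow> j < card B \<Longrightarrow>
      principal_submatrix A B $$ (i, j) = A $$ (pick B i, pick B j)"
proof -
  have "{i. i < n \<and> i \<in> B} = B" using assms(2) by auto
  then show "principal_submatrix A B \<in> carrier_mat (card B) (card B)"
    "\<And>i j. i < card B \<Longrightarrow> j < card B \<Longrightarrow>
      principal_submatrix A B $$ (i, j) = A $$ (pick B i, pick B j)"
    using assms(1) by (auto simp: principal_submatrix_def submatrix_def)
qed

text \<open>Relabelling vertices by \<open>pick B\<close> turns words over the row indices of the
  submatrix into words over \<open>B\<close> of the same weight.\<close>

lemma sum_walk_weight_principal_submatrix:
  assumes A: "A \<in> carrier_mat n n" and B: "B \<subseteq> {..<n}"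
  shows "(\<Sum>xs | set xs \<subseteq> {..<card B} \<and> length xs = k. walk_weight (principal_submatrix A B) xs) =
    (\<Sum>xs | set xs \<subseteq> B \<and> length xs = k. walk_weight A xs)"
proof -
  have bij: "bij_betw (pick B) {..<card B} B"
    using B by (intro bij_betw_pick) (rule finite_subset, auto)
  have "bij_betw (map (pick B)) {xs. set xs \<subseteq> {..<card B} \<and> length xs = k} {xs. set xs \<subseteq> B \<and> length xs = k}"
  proof (rule bij_betw_subset[OF bij_lists[OF bij]])
    have *: "{xs. set xs \<subseteq> S \<and> length xs = k} = {xs \<in> lists S. length xs = k}" for S :: "nat set"
      by auto
    have "{xs \<in> lists B. length xs = k} = map (pick B) ` {xs \<in> lists {..<card B}. length xs = k}"
      unfolding bij_betw_imp_surj_on[OF bij_lists[OF bij], symmetric] by auto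
    then show "map (pick B) ` {xs. set xs \<subseteq> {..<card B} \<and> length xs = k} = {xs. set xs \<subseteq> B \<and> length xs = k}"
      unfolding * by simp
  qed auto
  moreover have "walk_weight (principal_submatrix A B) xs = walk_weight A (map (pick B) xs)"
    if "set xs \<subseteq> {..<card B}" for xs
  proof -
    have "xs ! i < card B" if "i < length xs" for i
      using \<open>set xs \<subseteq> {..<card B}\<close> nth_mem[OF that] by auto
    moreover have "(i + 1) mod length xs < length xs" if "i < length xs" for i
      using that by (intro mod_less_divisor) auto
    ultimately show ?thesis
      unfolding walk_weight_def
      by (auto intro!: prod.cong simp: principal_submatrix_index(2)[OF A B])
  qed
  ultimately show ?thesis
    by (subst sum.reindex_bij_betw[symmetric, where g = "walk_weight A"]) (auto intro!: sum.cong)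
qed

subsection \<open>The product over orbits\<close>

text \<open>The bridge between trace series and sums over words. The grade \<open>k\<close> is the
  length minus one, which leaves out the empty word.\<close>

lemma has_sum_lists_by_length:
  "((\<lambda>(k, xs). f xs) has_sum s) (SIGMA k:UNIV. {xs. set xs \<subseteq> S \<and> length xs = Suc k}) \<longleftrightarrow>
    (f has_sum s) {xs. xs \<noteq> [] \<and> set xs \<subseteq> S}"
  by (rule has_sum_reindex_bij_witness[where i = "\<lambda>xs. (length xs - 1, xs)" and j = snd]) auto

lemma walk_weight_abs:
  assumes "A \<in> carrier_mat n n" "set xs \<subseteq> {..<n}"
  shows "walk_weight (map_mat abs A) xs = \<bar>walk_weight A xs\<bar>"
proof -
  have "map_mat abs A $$ (xs ! i, xs ! ((i + 1) mod length xs)) =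
      \<bar>A $$ (xs ! i, xs ! ((i + 1) mod length xs))\<bar>" if i: "i < length xs" for i
  proof -
    have "(i + 1) mod length xs < length xs" using i by (intro mod_less_divisor) auto
    then have "xs ! i < n" "xs ! ((i + 1) mod length xs) < n"
      using assms(2) i nth_mem by blast+
    then show ?thesis using assms(1) by simp
  qed
  then show ?thesis unfolding walk_weight_def abs_prod by (intro prod.cong) auto
qed

text \<open>Traces of powers of the absolute value of \<open>A\<close> are the sums of absolute
  weights of fixed length. All terms are nonnegative, so convergence of the graded series already
  gives summability over all words.\<close>

lemma walk_weight_abs_summable:
  assumes A: "A \<in> carrier_mat n n"
    and sr: "spectral_radius (map_mat complex_of_real (map_mat abs A)) < 1"
  shows "(\<lambda>xs. norm (walk_weight A xs)) summable_on {xs. xs \<noteq> [] \<and> set xs \<subseteq> {..<n}}"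
proof -
  let ?C = "map_mat abs A" and ?L = "\<lambda>k. {xs. set xs \<subseteq> {..<n} \<and> length xs = Suc k}"
  have C: "?C \<in> carrier_mat n n" "map_mat complex_of_real ?C \<in> carrier_mat n n" using A by auto
  have fin: "finite (?L k)" for k by (rule finite_lists_length_eq) simp
  have "summable (\<lambda>k. \<Sum>i<n. (?C ^\<^sub>m Suc k) $$ (i, i))"
    using summable_trace_pow_mat[OF C(1)] norm_eigenvalue_less_1[OF C(2) sr]
    by (subst summable_Suc_iff) blast
  moreover have "(\<Sum>i<n. (?C ^\<^sub>m Suc k) $$ (i, i)) = (\<Sum>xs\<in>?L k. \<bar>walk_weight A xs\<bar>)" for k
    unfolding trace_pow_mat_sum_walks[OF C(1)]
    by (intro sum.cong refl walk_weight_abs[OF A]) auto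
  ultimately have "(\<lambda>k. \<Sum>xs\<in>?L k. \<bar>walk_weight A xs\<bar>) summable_on UNIV"
    by (intro summable_nonneg_imp_summable_on) (auto intro: sum_nonneg)
  then have "(\<lambda>(k, xs). \<bar>walk_weight A xs\<bar>) summable_on (SIGMA k:UNIV. ?L k)"
    by (rule summable_on_SigmaI[rotated]) (auto intro!: has_sum_finite fin)
  then show ?thesis
    unfolding summable_on_def has_sum_lists_by_length by simp
qed

text \<open>Absolute convergence permits grouping by length, and the group of length
  \<open>Suc k\<close> is the corresponding term of the trace series for the block.\<close>

lemma has_sum_walks_log_det:
  assumes A: "A \<in> carrier_mat n n"
    and sr: "spectral_radius (map_mat complex_of_real (map_mat abs A)) < 1"
    and B: "B \<subseteq> {..<n}"
  shows "\<exists>s. ((\<lambda>xs. walk_weight A xs / real (length xs)) has_sum s) {xs. xs \<noteq> [] \<and> set xs \<subseteq> B} \<and>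
    det (1\<^sub>m (dim_row (principal_submatrix A B)) - principal_submatrix A B) = exp (- s)"
proof -
  let ?M = "principal_submatrix A B" and ?L = "\<lambda>k. {xs. set xs \<subseteq> B \<and> length xs = Suc k}"
  let ?f = "\<lambda>xs. walk_weight A xs / real (length xs)"
  note M = principal_submatrix_index[OF A B]
  have finB: "finite B" using B by (rule finite_subset) simp
  note bij = bij_betw_pick[OF finB]
  have fin: "finite (?L k)" for k by (rule finite_lists_length_eq[OF finB])
  obtain s where s: "(\<lambda>k. (\<Sum>i<card B. (?M ^\<^sub>m Suc k) $$ (i, i)) / real (Suc k)) sums s"
    and det: "det (1\<^sub>m (card B) - ?M) = exp (- s)"
  proof (rule det_eq_exp_trace_series[OF M(1)])
    show "norm z < 1" if "eigenvalue (map_mat complex_of_real ?M) z" for z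
      using bij B by (intro norm_eigenvalue_reindex_less_1[OF A M(1) _ _ M(2) sr that])
        (auto simp: bij_betw_def)
  qed
  have "(\<lambda>xs. norm (walk_weight A xs)) summable_on {xs. xs \<noteq> [] \<and> set xs \<subseteq> B}"
    using walk_weight_abs_summable[OF A sr] by (rule summable_on_subset) (use B in auto)
  then have "(\<lambda>xs. norm (?f xs)) summable_on {xs. xs \<noteq> [] \<and> set xs \<subseteq> B}"
  proof (rule Infinite_Sum.abs_summable_on_comparison_test)
    fix xs :: "nat list" assume "xs \<in> {xs. xs \<noteq> [] \<and> set xs \<subseteq> B}"
    then have "real (length xs) \<ge> 1" by (cases xs) auto
    then have "\<bar>walk_weight A xs\<bar> * 1 \<le> \<bar>walk_weight A xs\<bar> * real (length xs)"
      by (intro mult_left_mono) auto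
    then show "norm (?f xs) \<le> norm (walk_weight A xs)"
      using \<open>real (length xs) \<ge> 1\<close> by (simp add: divide_le_eq)
  qed
  then have "?f summable_on {xs. xs \<noteq> [] \<and> set xs \<subseteq> B}" by (rule abs_summable_summable)
  then obtain S where S: "(?f has_sum S) {xs. xs \<noteq> [] \<and> set xs \<subseteq> B}"
    unfolding summable_on_def by blast
  then have "((\<lambda>(k, xs). ?f xs) has_sum S) (SIGMA k:UNIV. ?L k)"
    unfolding has_sum_lists_by_length .
  then have "((\<lambda>k. \<Sum>xs\<in>?L k. ?f xs) has_sum S) UNIV"
    by (rule has_sum_SigmaD) (simp only: case_prod_conv has_sum_finite[OF fin])
  then have "(\<lambda>k. \<Sum>xs\<in>?L k. ?f xs) sums S" by (rule has_sum_imp_sums)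
  moreover have "(\<Sum>xs\<in>?L k. ?f xs) = (\<Sum>i<card B. (?M ^\<^sub>m Suc k) $$ (i, i)) / real (Suc k)" for k
    unfolding trace_pow_mat_sum_walks[OF M(1)] sum_walk_weight_principal_submatrix[OF A B] sum_divide_distrib
    by (intro sum.cong) auto
  ultimately have "S = s" using s sums_unique2 by simp
  then show ?thesis using S det M(1) by auto
qed

lemma has_sum_sum:
  fixes f :: "'i \<Rightarrow> 'a \<Rightarrow> 'b :: topological_comm_monoid_add"
  assumes "finite I" "\<And>i. i \<in> I \<Longrightarrow> (f i has_sum s i) X"
  shows "((\<lambda>x. \<Sum>i\<in>I. f i x) has_sum (\<Sum>i\<in>I. s i)) X"
  using assms by (induction I) (auto intro!: has_sum_add)

text \<open>The total \<open>T\<close> is the combination of the block sums with the block weights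
  as coefficients. A word then appears with the total weight of the blocks that contain it, which is
  1.\<close>

lemma has_sum_walks_log_Z:
  assumes A: "A \<in> carrier_mat n n"
    and sr: "spectral_radius (map_mat complex_of_real (map_mat abs A)) < 1"
    and fin: "finite \<B>" and sub: "\<forall>B\<in>\<B>. B \<subseteq> {..<n}"
    and inter: "\<forall>B\<in>\<B>. \<forall>B'\<in>\<B>. B \<inter> B' \<in> \<B>"
  shows "\<exists>T. ((\<lambda>xs. walk_weight A xs / real (length xs)) has_sum T)
      {xs. xs \<noteq> [] \<and> (\<exists>B\<in>\<B>. set xs \<subseteq> B)} \<and> Z_blocks A \<B> = exp T"
proof -
  let ?f = "\<lambda>xs. walk_weight A xs / real (length xs)"
  let ?U = "{xs. xs \<noteq> [] \<and> (\<exists>B\<in>\<B>. set xs \<subseteq> B)}"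
  let ?w = "\<lambda>B. real_of_int (block_weight \<B> B)"
  have "\<forall>B\<in>\<B>. \<exists>s. (?f has_sum s) {xs. xs \<noteq> [] \<and> set xs \<subseteq> B} \<and>
    det (1\<^sub>m (dim_row (principal_submatrix A B)) - principal_submatrix A B) = exp (- s)"
    using has_sum_walks_log_det[OF A sr] sub by blast
  from bchoice[OF this] obtain s where
    s: "\<And>B. B \<in> \<B> \<Longrightarrow> (?f has_sum s B) {xs. xs \<noteq> [] \<and> set xs \<subseteq> B}" and
    det: "\<And>B. B \<in> \<B> \<Longrightarrow>
      det (1\<^sub>m (dim_row (principal_submatrix A B)) - principal_submatrix A B) = exp (- s B)"
    by blast
  \<comment> \<open>Extension by zero brings all block sums to one index set, where they can be
    added termwise.\<close>
  have "((\<lambda>xs. if set xs \<subseteq> B then ?f xs else 0) has_sum s B) ?U" if "B \<in> \<B>" for B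
    using s[OF that] by (rule has_sum_cong_neutral[THEN iffD1, rotated 3]) (use that in auto)
  then have total: "((\<lambda>xs. \<Sum>B\<in>\<B>. ?w B * (if set xs \<subseteq> B then ?f xs else 0)) has_sum (\<Sum>B\<in>\<B>. ?w B * s B)) ?U"
    by (intro has_sum_sum[OF fin] has_sum_cmult_right)
  have pointwise: "(\<Sum>B\<in>\<B>. ?w B * (if set xs \<subseteq> B then ?f xs else 0)) = ?f xs" if "xs \<in> ?U" for xs
  proof -
    have "(\<Sum>B\<in>\<B>. ?w B * (if set xs \<subseteq> B then ?f xs else 0)) =
        (\<Sum>B\<in>\<B>. if set xs \<subseteq> B then ?w B * ?f xs else 0)"
      by (intro sum.cong) auto
    also have "\<dots> = (\<Sum>B | B \<in> \<B> \<and> set xs \<subseteq> B. ?w B * ?f xs)"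
      using sum.inter_filter[OF fin, of "\<lambda>B. ?w B * ?f xs" "\<lambda>B. set xs \<subseteq> B"] by simp
    also have "\<dots> = real_of_int (\<Sum>B | B \<in> \<B> \<and> set xs \<subseteq> B. block_weight \<B> B) * ?f xs"
      by (simp only: sum_distrib_right of_int_sum)
    also have "\<dots> = ?f xs"
      using sum_block_weights_covering[OF fin inter, of "set xs"] that by simp
    finally show ?thesis .
  qed
  have "(?f has_sum (\<Sum>B\<in>\<B>. ?w B * s B)) ?U"
    by (rule iffD1[OF has_sum_cong total]) (rule pointwise)
  moreover have "Z_blocks A \<B> = exp (\<Sum>B\<in>\<B>. ?w B * s B)"
    unfolding Z_blocks_def exp_sum[OF fin]
  proof (intro prod.cong refl)
    fix B assume "B \<in> \<B>"
    then show "inverse (det (1\<^sub>m (dim_row (principal_submatrix A B)) - principal_submatrix A B)) powi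
        block_weight \<B> B = exp (?w B * s B)"
      by (simp add: det exp_minus exp_power_int mult.commute)
  qed
  ultimately show ?thesis by blast
qed

text \<open>The powers of \<open>xs\<close> are distinct words whose weights form a geometric
  sequence, which must be summable. The bound makes the logarithms of \<open>1 - A^l\<close>
  meaningful.\<close>

lemma abs_walk_weight_less_1:
  assumes A: "A \<in> carrier_mat n n"
    and sr: "spectral_radius (map_mat complex_of_real (map_mat abs A)) < 1"
    and xs: "xs \<noteq> []" "set xs \<subseteq> {..<n}"
  shows "\<bar>walk_weight A xs\<bar> < 1"
proof -
  let ?p = "\<lambda>k. concat (replicate (Suc k) xs)"
  have "inj ?p"
  proof (rule injI)
    fix j k assume "?p j = ?p k"
    then have "length (?p j) = length (?p k)" by simp
    then show "j = k" using xs(1) by (simp only: length_concat_replicate) simp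
  qed
  moreover have "(\<lambda>xs. norm (walk_weight A xs)) summable_on range ?p"
    using walk_weight_abs_summable[OF A sr]
    by (rule summable_on_subset) (use xs set_concat_replicate[of _ xs] in auto)
  ultimately have "(\<lambda>k. norm (walk_weight A (?p k))) summable_on UNIV"
    using summable_on_reindex[of ?p UNIV "\<lambda>xs. norm (walk_weight A xs)"] by (simp add: o_def)
  then have "summable (\<lambda>k. \<bar>walk_weight A xs\<bar> ^ Suc k)"
    unfolding walk_weight_power real_norm_def power_abs by (rule summable_on_imp_summable)
  then have "summable (\<lambda>k. \<bar>walk_weight A xs\<bar> ^ k)" by (subst (asm) summable_Suc_iff)
  then show ?thesis by (simp add: summable_geometric_iff)
qed

section \<open>From closed walks to primitive walks and orbits\<close>

lemma bij_betw_primitive_powers: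
  assumes "\<And>k xs. k > 0 \<Longrightarrow> concat (replicate k xs) \<in> C \<longleftrightarrow> xs \<in> C" "[] \<notin> C"
  shows "bij_betw (\<lambda>(p, k). concat (replicate (Suc k) p)) ({p \<in> C. primitive_walk p} \<times> UNIV) C"
  unfolding bij_betw_def
proof
  show "inj_on (\<lambda>(p, k). concat (replicate (Suc k) p)) ({p \<in> C. primitive_walk p} \<times> UNIV)"
  proof (rule inj_onI, clarify)
    fix p q :: "nat list" and j k :: nat
    assume "p \<in> C" "primitive_walk p" "q \<in> C" "primitive_walk q"
      and eq: "concat (replicate (Suc j) p) = concat (replicate (Suc k) q)"
    then have "p \<noteq> []" "q \<noteq> []" using assms(2) by auto
    from primitive_root_unique[OF \<open>primitive_walk p\<close> \<open>primitive_walk q\<close> this _ _ eq]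
    show "p = q \<and> j = k" by simp
  qed
  show "(\<lambda>(p, k). concat (replicate (Suc k) p)) ` ({p \<in> C. primitive_walk p} \<times> UNIV) = C"
  proof (intro equalityI subsetI)
    fix xs assume xs: "xs \<in> C"
    then have "xs \<noteq> []" using assms(2) by auto
    then obtain p k where p: "primitive_walk p" "k > 0" "xs = concat (replicate k p)"
      by (rule primitive_root_exists)
    then have "p \<in> C" using assms(1) xs by simp
    moreover obtain j where "k = Suc j" using p(2) by (cases k) auto
    ultimately show "xs \<in> (\<lambda>(p, k). concat (replicate (Suc k) p)) ` ({p \<in> C. primitive_walk p} \<times> UNIV)"
      using p by (intro image_eqI[of _ _ "(p, j)"]) auto
  next
    fix xs assume "xs \<in> (\<lambda>(p, k). concat (replicate (Suc k) p)) ` ({p \<in> C. primitive_walk p} \<times> UNIV)"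
    then obtain p k where "p \<in> C" "xs = concat (replicate (Suc k) p)" by auto
    then show "xs \<in> C" using assms(1)[of "Suc k" p] by (simp only: zero_less_Suc)
  qed
qed

text \<open>Every member is as good as the chosen representative, because shifts preserve
  closedness, primitivity, weight and vertex set.\<close>

lemma orbit_properties:
  assumes l: "l \<in> orbits A" and p: "p \<in> l"
  shows "closed_walk A p" "primitive_walk p" "l = {rotate i p | i. True}"
    "finite l" "card l = length p" "orbit_weight A l = walk_weight A p"
    "covered_by l B \<longleftrightarrow> set p \<subseteq> B"
proof -
  obtain xs where xs: "closed_walk A xs" "primitive_walk xs" "l = {rotate i xs | i. True}"
    using l unfolding orbits_def by blast
  obtain j where j: "p = rotate j xs" using p xs(3) by blast
  show p': "closed_walk A p" "primitive_walk p"
    unfolding j by (simp_all add: closed_walk_rotate primitive_walk_rotate xs)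
  show lp: "l = {rotate i p | i. True}" using rotation_class_eqI[of p xs] p xs(3) by simp
  have ne: "p \<noteq> []" using p'(1) by (simp add: closed_walk_def)
  show "finite l" unfolding lp rotation_class_eq_image[OF ne] by simp
  show "card l = length p" unfolding lp by (rule card_rotation_class[OF p'(2) ne])
  have "(SOME xs. xs \<in> l) \<in> l" using p by (rule someI)
  then show "orbit_weight A l = walk_weight A p"
    unfolding orbit_weight_def using lp walk_weight_rotate by auto
  show "covered_by l B \<longleftrightarrow> set p \<subseteq> B" unfolding covered_by_def using p lp by auto
qed

lemma orbit_nonempty: "l \<in> orbits A \<Longrightarrow> l \<noteq> {}"
  unfolding orbits_def by blast

lemma primitive_closed_walk_in_orbit:
  assumes "closed_walk A p" "primitive_walk p"
  shows "{rotate i p | i. True} \<in> orbits A" "p \<in> {rotate i p | i. True}"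
  using assms unfolding orbits_def by (auto intro: exI[of _ "0::nat"])

text \<open>The sum is regrouped twice: by primitive root and exponent, where the inner sums are
  logarithm series, and then by orbit, where equal terms cancel the division by the length.\<close>

lemma has_sum_orbits_log:
  assumes A: "A \<in> carrier_mat n n"
    and sr: "spectral_radius (map_mat complex_of_real (map_mat abs A)) < 1"
    and sub: "\<forall>B\<in>\<B>. B \<subseteq> {..<n}"
    and T: "((\<lambda>xs. walk_weight A xs / real (length xs)) has_sum T)
      {xs. xs \<noteq> [] \<and> (\<exists>B\<in>\<B>. set xs \<subseteq> B)}"
  shows "((\<lambda>l. - ln (1 - orbit_weight A l)) has_sum T) {l \<in> orbits A. \<exists>B\<in>\<B>. covered_by l B}"
proof -
  let ?f = "\<lambda>xs. walk_weight A xs / real (length xs)"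
  let ?g = "\<lambda>p. - ln (1 - walk_weight A p) / real (length p)"
  define C where "C = {xs. closed_walk A xs \<and> (\<exists>B\<in>\<B>. set xs \<subseteq> B)}"
  define P where "P = {p \<in> C. primitive_walk p}"
  define L where "L = {l \<in> orbits A. \<exists>B\<in>\<B>. covered_by l B}"
  have "(?f has_sum T) C"
    using T
  proof (rule has_sum_cong_neutral[THEN iffD1, rotated 3])
    fix xs assume "xs \<in> {xs. xs \<noteq> [] \<and> (\<exists>B\<in>\<B>. set xs \<subseteq> B)} - C"
    then show "?f xs = 0" using A sub unfolding C_def closed_walk_iff_weight by auto
  next
    fix xs assume "xs \<in> C - {xs. xs \<noteq> [] \<and> (\<exists>B\<in>\<B>. set xs \<subseteq> B)}"
    then show "?f xs = 0" unfolding C_def closed_walk_def by auto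
  qed simp
  moreover have "bij_betw (\<lambda>(p, k). concat (replicate (Suc k) p)) (P \<times> UNIV) C"
    unfolding P_def
    by (rule bij_betw_primitive_powers)
      (auto simp: C_def closed_walk_power set_concat_replicate, simp add: closed_walk_def)
  ultimately have "((\<lambda>(p, k). ?f (concat (replicate (Suc k) p))) has_sum T) (P \<times> UNIV)"
    by (subst (asm) has_sum_reindex_bij_betw[symmetric]) (auto simp: case_prod_unfold)
  then have "(?g has_sum T) P"
  proof (rule has_sum_SigmaD)
    fix p assume "p \<in> P"
    then have p: "p \<noteq> []" "set p \<subseteq> {..<n}"
      using A by (auto simp: P_def C_def closed_walk_def)
    let ?x = "walk_weight A p"
    have x: "\<bar>?x\<bar> < 1" by (rule abs_walk_weight_less_1[OF A sr p])
    have "(\<lambda>k. ?x ^ Suc k / real (Suc k)) sums - ln (1 - ?x)"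
      by (rule sums_minus_ln[OF x])
    \<comment> \<open>The series of norms is the logarithm series at the absolute value of the
      weight.\<close>
    moreover have "summable (\<lambda>k. norm (?x ^ Suc k / real (Suc k)))"
      using sums_summable[OF sums_minus_ln[of "\<bar>?x\<bar>"]] x
      by (simp add: abs_mult power_abs del: of_nat_Suc)
    ultimately have "((\<lambda>k. ?x ^ Suc k / real (Suc k)) has_sum - ln (1 - ?x)) UNIV"
      by (intro norm_summable_imp_has_sum)
    then have "((\<lambda>k. ?x ^ Suc k / real (Suc k) / real (length p)) has_sum ?g p) UNIV"
      by (rule has_sum_divide_const)
    then show "((\<lambda>k. case (p, k) of (p, k) \<Rightarrow> ?f (concat (replicate (Suc k) p))) has_sum ?g p) UNIV"
      unfolding case_prod_conv walk_weight_power length_concat_replicate of_nat_mult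
      by (simp only: divide_divide_eq_left)
  qed
  \<comment> \<open>A primitive walk lies in exactly one orbit, its class of shifts, so pairs of an
    orbit and a member amount to primitive walks.\<close>
  moreover have "bij_betw snd (SIGMA l:L. l) P"
  proof (rule bij_betwI[where g = "\<lambda>p. ({rotate i p | i. True}, p)"])
    show "snd \<in> (SIGMA l:L. l) \<rightarrow> P"
    proof
      fix q assume "q \<in> (SIGMA l:L. l)"
      then have q: "fst q \<in> orbits A" "snd q \<in> fst q" "\<exists>B\<in>\<B>. covered_by (fst q) B"
        unfolding L_def by (auto simp: mem_Sigma_iff split_beta)
      note orb = orbit_properties[OF q(1,2)]
      show "snd q \<in> P"
        using orb(1,2) q(3) unfolding orb(7) P_def C_def by simp
    qed
    show "(\<lambda>p. ({rotate i p | i. True}, p)) \<in> P \<rightarrow> (SIGMA l:L. l)"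
    proof
      fix p assume "p \<in> P"
      then have p: "closed_walk A p" "primitive_walk p" "\<exists>B\<in>\<B>. set p \<subseteq> B"
        unfolding P_def C_def by auto
      note orb = primitive_closed_walk_in_orbit[OF p(1,2)]
      show "({rotate i p | i. True}, p) \<in> (SIGMA l:L. l)"
        using orb orbit_properties(7)[OF orb] p(3) unfolding L_def by simp
    qed
    show "({rotate i (snd q) | i. True}, snd q) = q" if "q \<in> (SIGMA l:L. l)" for q
    proof -
      have "fst q \<in> orbits A" "snd q \<in> fst q" using that unfolding L_def by auto
      from orbit_properties(3)[OF this] show ?thesis by (intro prod_eqI) simp_all
    qed
  qed simp
  ultimately have "((\<lambda>q. ?g (snd q)) has_sum T) (SIGMA l:L. l)"
    by (subst has_sum_reindex_bij_betw)
  then have "((\<lambda>l. - ln (1 - orbit_weight A l)) has_sum T) L"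
  proof (rule has_sum_SigmaD)
    fix l assume "l \<in> L"
    then have l: "l \<in> orbits A" unfolding L_def by simp
    obtain p where p: "p \<in> l" using orbit_nonempty[OF l] by blast
    note orb = orbit_properties[OF l]
    have "(\<Sum>q\<in>l. ?g q) = (\<Sum>q\<in>l. - ln (1 - orbit_weight A l) / real (card l))"
      using orb by (intro sum.cong) auto
    also have "\<dots> = - ln (1 - orbit_weight A l)" using orb(4)[OF p] p by auto
    finally show "((\<lambda>q. ?g (snd (l, q))) has_sum - ln (1 - orbit_weight A l)) l"
      using orb(4)[OF p] by (intro has_sum_finiteI) auto
  qed
  then show ?thesis unfolding L_def .
qed

text \<open>The infinite product is the limit along the finite sets of orbits ordered by inclusion,
  so its convergence does not depend on an enumeration. It follows by applying the continuous
  function \<open>exp\<close> to the partial sums of logarithms.\<close>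

theorem theorem6:
  fixes A :: "real mat" and N L :: nat and \<B> :: "nat set set"
  assumes "A \<in> carrier_mat N N"
    and "spectral_radius (map_mat complex_of_real (map_mat abs A)) < 1"
    and "L \<ge> 1"
    and "finite \<B>" and "\<forall>B\<in>\<B>. B \<subseteq> {..<N}"
    and "\<forall>l\<in>orbits A. orbit_len l < L \<longrightarrow> (\<exists>B\<in>\<B>. covered_by l B)"
    and "\<forall>B\<in>\<B>. \<forall>B'\<in>\<B>. B \<inter> B' \<in> \<B>"
  shows "((\<lambda>F. \<Prod>l\<in>F. inverse (1 - orbit_weight A l)) \<longlongrightarrow> Z_blocks A \<B>)
           (finite_subsets_at_top {l \<in> orbits A. \<exists>B\<in>\<B>. covered_by l B})"
proof -
  let ?L = "{l \<in> orbits A. \<exists>B\<in>\<B>. covered_by l B}"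
  obtain T where T: "((\<lambda>xs. walk_weight A xs / real (length xs)) has_sum T)
      {xs. xs \<noteq> [] \<and> (\<exists>B\<in>\<B>. set xs \<subseteq> B)}" and Z: "Z_blocks A \<B> = exp T"
    using has_sum_walks_log_Z[OF assms(1,2,4,5,7)] by blast
  have "((\<lambda>F. exp (\<Sum>l\<in>F. - ln (1 - orbit_weight A l))) \<longlongrightarrow> exp T) (finite_subsets_at_top ?L)"
    using has_sum_orbits_log[OF assms(1,2,5) T] unfolding has_sum_def by (rule tendsto_exp)
  moreover have "exp (\<Sum>l\<in>F. - ln (1 - orbit_weight A l)) = (\<Prod>l\<in>F. inverse (1 - orbit_weight A l))"
    if F: "finite F" "F \<subseteq> ?L" for F
    unfolding exp_sum[OF F(1)]
  proof (intro prod.cong refl)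
    fix l assume "l \<in> F"
    then have l: "l \<in> orbits A" using F(2) by auto
    then obtain p where p: "p \<in> l" using orbit_nonempty by blast
    note orb = orbit_properties[OF l p]
    \<comment> \<open>This makes \<open>1 - orbit_weight A l\<close> positive, so that
      \<open>exp\<close> undoes the real logarithm.\<close>
    have "\<bar>orbit_weight A l\<bar> < 1"
      unfolding orb(6) using orb(1) assms(1)
      by (intro abs_walk_weight_less_1[OF assms(1,2)]) (auto simp: closed_walk_def)
    then show "exp (- ln (1 - orbit_weight A l)) = inverse (1 - orbit_weight A l)"
      by (simp add: exp_minus)
  qed
  ultimately show ?thesis unfolding Z
    by (subst (asm) tendsto_cong) (auto intro!: eventually_finite_subsets_at_top_weakI)
qed

end
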